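(* Let $\chi\colon\mathbb T\mathbb S\to\mathbb S\mathbb T$ be a comonad distributive law between comonads $\mathbb T=(T,\Delta^T,\epsilon^T)$ and $\mathbb S=(S,\Delta^S,\epsilon^S)$ on a category $\mathcal B$. Then: (1) Any $\mathbb S$-coalgebra $(M,\mathcal Y,\nabla^S)$ defines a right $\chi$-coalgebra $(M,\mathcal Y,\epsilon^T\nabla^S)$, where $\epsilon^T\nabla^S$ is the horizontal composite $\nabla^S\circ\epsilon^TM\colon TM\to M\to SM$. (2) Any $\mathbb T$-opcoalgebra $(N,\mathcal Z,\nabla^T)$ defines a left $\chi$-coalgebra $(N,\mathcal Z,\nabla^T\epsilon^S)$, where $\nabla^T\epsilon^S$ is the horizontal composite $\nabla^T\circ N\epsilon^S\colon NS\to N\to NT$.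
   Context: Juxtaposition denotes composition of functors and whiskering. A comonad distributive law $\chi\colon\mathbb T\mathbb S\to\mathbb S\mathbb T$ is a natural transformation $\chi\colon TS\to ST$ with $S\epsilon^T\circ\chi=\epsilon^TS$, $S\Delta^T\circ\chi=\chi T\circ T\chi\circ\Delta^TS$, $\epsilon^ST\circ\chi=T\epsilon^S$, $\Delta^ST\circ\chi=S\chi\circ\chi S\circ T\Delta^S$. An $\mathbb S$-coalgebra $(M,\mathcal Y,\nabla^S)$ is a functor $M\colon\mathcal Y\to\mathcal B$ with a natural transformation $\nabla^S\colon M\to SM$ such that $\Delta^SM\circ\nabla^S=S\nabla^S\circ\nabla^S$ and $\epsilon^SM\circ\nabla^S=\mathrm{id}$. A $\mathbb T$-opcoalgebra $(N,\mathcal Z,\nabla^T)$ is a functor $N\colon\mathcal B\to\mathcal Z$ with a natural transformation $\nabla^T\colon N\to NT$ such that $N\Delta^T\circ\nabla^T=\nabla^TT\circ\nabla^T$ and $N\epsilon^T\circ\nabla^T=\mathrm{id}$. A right $\chi$-coalgebra $(M,\mathcal Y,\rho)$ is a functor $M\colon\mathcal Y\to\mathcal B$ with a natural transformation $\rho\colon TM\to SM$ such that $\epsilon^SM\circ\rho=\epsilon^TM$ and $\Delta^SM\circ\rho=S\rho\circ\chi M\circ T\rho\circ\Delta^TM$. Dually, a left $\chi$-coalgebra $(N,\mathcal Z,\lambda)$ is a functor $N\colon\mathcal B\to\mathcal Z$ with a natural transformation $\lambda\colon NS\to NT$ such that $N\epsilon^T\circ\lambda=N\epsilon^S$ and $N\Delta^T\circ\lambda=\lambda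 T\circ N\chi\circ\lambda S\circ N\Delta^S$. *)

theory Defs
  imports Main
begin

record ('o, 'm) cat =
  Ob :: "'o set"
  Ar :: "'m set"
  Dom :: "'m \<Rightarrow> 'o"
  Cod :: "'m \<Rightarrow> 'o"
  Idn :: "'o \<Rightarrow> 'm"
  Cmp :: "'m \<Rightarrow> 'm \<Rightarrow> 'm"  (infixr "\<cdot>\<index>" 70)

definition hom :: "('o, 'm) cat \<Rightarrow> 'o \<Rightarrow> 'o \<Rightarrow> 'm set"
  where "hom C x y = {f \<in> Ar C. Dom C f = x \<and> Cod C f = y}"

locale category =
  fixes C :: "('o, 'm) cat"
  assumes dom_closed: "f \<in> Ar C \<Longrightarrow> Dom C f \<in> Ob C"
    and cod_closed: "f \<in> Ar C \<Longrightarrow> Cod C f \<in> Ob C"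
    and idn_hom: "x \<in> Ob C \<Longrightarrow> Idn C x \<in> hom C x x"
    and cmp_hom: "f \<in> hom C x y \<Longrightarrow> g \<in> hom C y z \<Longrightarrow> g \<cdot>\<^bsub>C\<^esub> f \<in> hom C x z"
    and cmp_idn_left: "f \<in> hom C x y \<Longrightarrow> Idn C y \<cdot>\<^bsub>C\<^esub> f = f"
    and cmp_idn_right: "f \<in> hom C x y \<Longrightarrow> f \<cdot>\<^bsub>C\<^esub> Idn C x = f"
    and cmp_assoc: "f \<in> hom C w x \<Longrightarrow> g \<in> hom C x y \<Longrightarrow> h \<in> hom C y z \<Longrightarrow>
      (h \<cdot>\<^bsub>C\<^esub> g) \<cdot>\<^bsub>C\<^esub> f = h \<cdot>\<^bsub>C\<^esub> (g \<cdot>\<^bsub>C\<^esub> f)"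

record ('o, 'm, 'p, 'n) func =
  omap :: "'o \<Rightarrow> 'p"
  amap :: "'m \<Rightarrow> 'n"

definition id_func :: "('o, 'm, 'o, 'm) func"  ("\<I>")
  where "\<I> = \<lparr>omap = (\<lambda>x. x), amap = (\<lambda>f. f)\<rparr>"

definition comp_func ::
  "('p, 'n, 'q, 'k) func \<Rightarrow> ('o, 'm, 'p, 'n) func \<Rightarrow> ('o, 'm, 'q, 'k) func"  (infixr "\<odot>" 80)
  where "G \<odot> F = \<lparr>omap = (\<lambda>x. omap G (omap F x)), amap = (\<lambda>f. amap G (amap F f))\<rparr>"

locale category_functor = source: category C + target: category D
  for C :: "('o, 'm) cat" and D :: "('p, 'n) cat" +
  fixes F :: "('o, 'm, 'p, 'n) func"
  assumes omap_closed: "x \<in> Ob C \<Longrightarrow> omap F x \<in> Ob D"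
    and amap_hom: "f \<in> hom C x y \<Longrightarrow> amap F f \<in> hom D (omap F x) (omap F y)"
    and amap_idn: "x \<in> Ob C \<Longrightarrow> amap F (Idn C x) = Idn D (omap F x)"
    and amap_cmp: "f \<in> hom C x y \<Longrightarrow> g \<in> hom C y z \<Longrightarrow>
      amap F (g \<cdot>\<^bsub>C\<^esub> f) = amap F g \<cdot>\<^bsub>D\<^esub> amap F f"

text \<open>
  A natural transformation is given by its family of components.  The values of this
  family outside the objects of the source category carry no information, so equality
  of natural transformations is agreement of components on objects.
\<close>

locale natural_transformation = source: category_functor C D F + target: category_functor C D G
  for C :: "('o, 'm) cat" and D :: "('p, 'n) cat"
    and F G :: "('o, 'm, 'p, 'n) func" +
  fixes \<alpha> :: "'o \<Rightarrow> 'n"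
  assumes component_hom: "x \<in> Ob C \<Longrightarrow> \<alpha> x \<in> hom D (omap F x) (omap G x)"
    and natural: "f \<in> hom C x y \<Longrightarrow> \<alpha> y \<cdot>\<^bsub>D\<^esub> amap F f = amap G f \<cdot>\<^bsub>D\<^esub> \<alpha> x"

definition nt_eq :: "('o, 'm) cat \<Rightarrow> ('o \<Rightarrow> 'n) \<Rightarrow> ('o \<Rightarrow> 'n) \<Rightarrow> bool"  (infix "\<doteq>\<index>" 50)
  where "\<alpha> \<doteq>\<^bsub>C\<^esub> \<beta> \<longleftrightarrow> (\<forall>x \<in> Ob C. \<alpha> x = \<beta> x)"

definition id_nt :: "('p, 'n) cat \<Rightarrow> ('o, 'm, 'p, 'n) func \<Rightarrow> 'o \<Rightarrow> 'n"
  where "id_nt D F = (\<lambda>x. Idn D (omap F x))"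

text \<open>In \<open>\<beta> \<bullet>\<^bsub>D\<^esub> \<alpha>\<close>, the index is the category in which the components are composed.\<close>

definition vcomp :: "('p, 'n) cat \<Rightarrow> ('o \<Rightarrow> 'n) \<Rightarrow> ('o \<Rightarrow> 'n) \<Rightarrow> 'o \<Rightarrow> 'n"  (infixr "\<bullet>\<index>" 60)
  where "\<beta> \<bullet>\<^bsub>D\<^esub> \<alpha> = (\<lambda>x. \<beta> x \<cdot>\<^bsub>D\<^esub> \<alpha> x)"

text \<open>\<open>F \<triangleright> \<alpha>\<close> has components \<open>F(\<alpha>\<^sub>x)\<close>, and \<open>\<alpha> \<triangleleft> F\<close> has components \<open>\<alpha>\<^bsub>Fx\<^esub>\<close>.\<close>

definition whisker_left :: "('p, 'n, 'q, 'k) func \<Rightarrow> ('o \<Rightarrow> 'n) \<Rightarrow> 'o \<Rightarrow> 'k"  (infixr "\<triangleright>" 75)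
  where "F \<triangleright> \<alpha> = (\<lambda>x. amap F (\<alpha> x))"

definition whisker_right :: "('p \<Rightarrow> 'n) \<Rightarrow> ('o, 'm, 'p, 'k) func \<Rightarrow> 'o \<Rightarrow> 'n"  (infixl "\<triangleleft>" 75)
  where "\<alpha> \<triangleleft> F = (\<lambda>x. \<alpha> (omap F x))"

text \<open>
  For \<open>\<alpha> : F \<rightarrow> G\<close> between functors \<open>C \<rightarrow> D\<close> and \<open>\<beta> : H \<rightarrow> K\<close> between functors
  \<open>D \<rightarrow> E\<close>, the horizontal composite \<open>\<beta>\<alpha> : HF \<rightarrow> KG\<close> is \<open>\<beta>G \<circ> H\<alpha>\<close>.
  Only the target \<open>E\<close> and the functors \<open>H\<close> and \<open>G\<close> enter this formula.
\<close>

definition hcomp :: "('q, 'k) cat \<Rightarrow> ('p, 'n, 'q, 'k) func \<Rightarrow> ('o, 'm, 'p, 'n) func \<Rightarrow>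
    ('p \<Rightarrow> 'k) \<Rightarrow> ('o \<Rightarrow> 'n) \<Rightarrow> 'o \<Rightarrow> 'k"
  where "hcomp E H G \<beta> \<alpha> = (\<beta> \<triangleleft> G) \<bullet>\<^bsub>E\<^esub> (H \<triangleright> \<alpha>)"

locale comonad =
  category_functor B B T +
  comult: natural_transformation B B T "T \<odot> T" \<Delta> +
  counit: natural_transformation B B T \<I> \<epsilon>
  for B :: "('o, 'm) cat" and T :: "('o, 'm, 'o, 'm) func" and \<Delta> \<epsilon> :: "'o \<Rightarrow> 'm" +
  assumes coassoc: "(T \<triangleright> \<Delta>) \<bullet>\<^bsub>B\<^esub> \<Delta> \<doteq>\<^bsub>B\<^esub> (\<Delta> \<triangleleft> T) \<bullet>\<^bsub>B\<^esub> \<Delta>"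
    and counit_left: "(\<epsilon> \<triangleleft> T) \<bullet>\<^bsub>B\<^esub> \<Delta> \<doteq>\<^bsub>B\<^esub> id_nt B T"
    and counit_right: "(T \<triangleright> \<epsilon>) \<bullet>\<^bsub>B\<^esub> \<Delta> \<doteq>\<^bsub>B\<^esub> id_nt B T"

locale comonad_distributive_law =
  T: comonad B T \<Delta>T \<epsilon>T +
  S: comonad B S \<Delta>S \<epsilon>S +
  law: natural_transformation B B "T \<odot> S" "S \<odot> T" \<chi>
  for B :: "('o, 'm) cat"
    and T :: "('o, 'm, 'o, 'm) func" and \<Delta>T \<epsilon>T :: "'o \<Rightarrow> 'm"
    and S :: "('o, 'm, 'o, 'm) func" and \<Delta>S \<epsilon>S :: "'o \<Rightarrow> 'm"
    and \<chi> :: "'o \<Rightarrow> 'm" +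
  assumes law_counit_T: "(S \<triangleright> \<epsilon>T) \<bullet>\<^bsub>B\<^esub> \<chi> \<doteq>\<^bsub>B\<^esub> \<epsilon>T \<triangleleft> S"
    and law_comult_T: "(S \<triangleright> \<Delta>T) \<bullet>\<^bsub>B\<^esub> \<chi> \<doteq>\<^bsub>B\<^esub> (\<chi> \<triangleleft> T) \<bullet>\<^bsub>B\<^esub> (T \<triangleright> \<chi>) \<bullet>\<^bsub>B\<^esub> (\<Delta>T \<triangleleft> S)"
    and law_counit_S: "(\<epsilon>S \<triangleleft> T) \<bullet>\<^bsub>B\<^esub> \<chi> \<doteq>\<^bsub>B\<^esub> T \<triangleright> \<epsilon>S"
    and law_comult_S: "(\<Delta>S \<triangleleft> T) \<bullet>\<^bsub>B\<^esub> \<chi> \<doteq>\<^bsub>B\<^esub> (S \<triangleright> \<chi>) \<bullet>\<^bsub>B\<^esub> (\<chi> \<triangleleft> S) \<bullet>\<^bsub>B\<^esub> (T \<triangleright> \<Delta>S)"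

locale coalgebra =
  comonad B S \<Delta> \<epsilon> +
  coact_source: category_functor Y B M +
  coact: natural_transformation Y B M "S \<odot> M" nabla
  for B :: "('o, 'm) cat" and S :: "('o, 'm, 'o, 'm) func" and \<Delta> \<epsilon> :: "'o \<Rightarrow> 'm"
    and Y :: "('yo, 'ym) cat" and M :: "('yo, 'ym, 'o, 'm) func" and nabla :: "'yo \<Rightarrow> 'm" +
  assumes coact_coassoc: "(\<Delta> \<triangleleft> M) \<bullet>\<^bsub>B\<^esub> nabla \<doteq>\<^bsub>Y\<^esub> (S \<triangleright> nabla) \<bullet>\<^bsub>B\<^esub> nabla"
    and coact_counit: "(\<epsilon> \<triangleleft> M) \<bullet>\<^bsub>B\<^esub> nabla \<doteq>\<^bsub>Y\<^esub> id_nt B M"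

locale opcoalgebra =
  comonad B T \<Delta> \<epsilon> +
  coact_source: category_functor B Z N +
  coact: natural_transformation B Z N "N \<odot> T" nabla
  for B :: "('o, 'm) cat" and T :: "('o, 'm, 'o, 'm) func" and \<Delta> \<epsilon> :: "'o \<Rightarrow> 'm"
    and Z :: "('zo, 'zm) cat" and N :: "('o, 'm, 'zo, 'zm) func" and nabla :: "'o \<Rightarrow> 'zm" +
  assumes coact_coassoc: "(N \<triangleright> \<Delta>) \<bullet>\<^bsub>Z\<^esub> nabla \<doteq>\<^bsub>B\<^esub> (nabla \<triangleleft> T) \<bullet>\<^bsub>Z\<^esub> nabla"
    and coact_counit: "(N \<triangleright> \<epsilon>) \<bullet>\<^bsub>Z\<^esub> nabla \<doteq>\<^bsub>B\<^esub> id_nt Z N"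

locale right_chi_coalgebra =
  comonad_distributive_law B T \<Delta>T \<epsilon>T S \<Delta>S \<epsilon>S \<chi> +
  coact_source: category_functor Y B M +
  coact: natural_transformation Y B "T \<odot> M" "S \<odot> M" \<rho>
  for B :: "('o, 'm) cat"
    and T :: "('o, 'm, 'o, 'm) func" and \<Delta>T \<epsilon>T :: "'o \<Rightarrow> 'm"
    and S :: "('o, 'm, 'o, 'm) func" and \<Delta>S \<epsilon>S :: "'o \<Rightarrow> 'm"
    and \<chi> :: "'o \<Rightarrow> 'm"
    and Y :: "('yo, 'ym) cat" and M :: "('yo, 'ym, 'o, 'm) func" and \<rho> :: "'yo \<Rightarrow> 'm" +
  assumes chi_counit: "(\<epsilon>S \<triangleleft> M) \<bullet>\<^bsub>B\<^esub> \<rho> \<doteq>\<^bsub>Y\<^esub> \<epsilon>T \<triangleleft> M"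
    and chi_comult: "(\<Delta>S \<triangleleft> M) \<bullet>\<^bsub>B\<^esub> \<rho> \<doteq>\<^bsub>Y\<^esub>
      (S \<triangleright> \<rho>) \<bullet>\<^bsub>B\<^esub> (\<chi> \<triangleleft> M) \<bullet>\<^bsub>B\<^esub> (T \<triangleright> \<rho>) \<bullet>\<^bsub>B\<^esub> (\<Delta>T \<triangleleft> M)"

locale left_chi_coalgebra =
  comonad_distributive_law B T \<Delta>T \<epsilon>T S \<Delta>S \<epsilon>S \<chi> +
  coact_source: category_functor B Z N +
  coact: natural_transformation B Z "N \<odot> S" "N \<odot> T" \<Lambda>
  for B :: "('o, 'm) cat"
    and T :: "('o, 'm, 'o, 'm) func" and \<Delta>T \<epsilon>T :: "'o \<Rightarrow> 'm"
    and S :: "('o, 'm, 'o, 'm) func" and \<Delta>S \<epsilon>S :: "'o \<Rightarrow> 'm"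
    and \<chi> :: "'o \<Rightarrow> 'm"
    and Z :: "('zo, 'zm) cat" and N :: "('o, 'm, 'zo, 'zm) func" and \<Lambda> :: "'o \<Rightarrow> 'zm" +
  assumes chi_counit: "(N \<triangleright> \<epsilon>T) \<bullet>\<^bsub>Z\<^esub> \<Lambda> \<doteq>\<^bsub>B\<^esub> N \<triangleright> \<epsilon>S"
    and chi_comult: "(N \<triangleright> \<Delta>T) \<bullet>\<^bsub>Z\<^esub> \<Lambda> \<doteq>\<^bsub>B\<^esub>
      (\<Lambda> \<triangleleft> T) \<bullet>\<^bsub>Z\<^esub> (N \<triangleright> \<chi>) \<bullet>\<^bsub>Z\<^esub> (\<Lambda> \<triangleleft> S) \<bullet>\<^bsub>Z\<^esub> (N \<triangleright> \<Delta>S)"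

end

theory Submission
  imports Defs
begin

text \<open>
  Naturality of \<open>\<epsilon>\<^sup>T\<close> moves it past \<open>\<nabla>\<^sup>S\<close>, so the composite has the two forms \<open>\<epsilon>\<^sup>TSM \<circ> T\<nabla>\<^sup>S\<close> and
  \<open>\<nabla>\<^sup>S \<circ> \<epsilon>\<^sup>TM\<close>.  On the right-hand side of the comultiplication axiom for \<open>\<rho> = \<nabla>\<^sup>S \<circ> \<epsilon>\<^sup>TM\<close>, the
  counit law of \<open>\<bbbT>\<close> absorbs \<open>\<Delta>\<^sup>T\<close> and the law \<open>S\<epsilon>\<^sup>T \<circ> \<chi> = \<epsilon>\<^sup>TS\<close> absorbs \<open>\<chi>\<close>; what remains is
  \<open>S\<nabla>\<^sup>S \<circ> \<epsilon>\<^sup>TSM \<circ> T\<nabla>\<^sup>S = S\<nabla>\<^sup>S \<circ> \<nabla>\<^sup>S \<circ> \<epsilon>\<^sup>TM\<close>, and coassociativity of \<open>\<nabla>\<^sup>S\<close> finishes.  The second part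
  is dual: \<open>\<epsilon>\<^sup>ST \<circ> \<chi> = T\<epsilon>\<^sup>S\<close> absorbs \<open>\<chi>\<close>, and naturality of \<open>\<nabla>\<^sup>T\<close> replaces that of \<open>\<epsilon>\<^sup>T\<close>.
\<close>

section \<open>Calculus of functors and natural transformations\<close>

lemma omap_id_func [simp]: "omap \<I> x = x"
  and amap_id_func [simp]: "amap \<I> f = f"
  by (simp_all add: id_func_def)

lemma omap_comp_func [simp]: "omap (G \<odot> F) x = omap G (omap F x)"
  and amap_comp_func [simp]: "amap (G \<odot> F) f = amap G (amap F f)"
  by (simp_all add: comp_func_def)

text \<open>These unit laws are equalities of records. They remove the factor \<open>\<I>\<close>
  that a counit puts into the source or target functor of a horizontal composite.\<close>

lemma comp_func_id_left [simp]: "\<I> \<odot> F = F"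
  and comp_func_id_right [simp]: "F \<odot> \<I> = F"
  by (simp_all add: comp_func_def id_func_def)

lemmas nt_component_defs = nt_eq_def vcomp_def whisker_left_def whisker_right_def id_nt_def hcomp_def

lemma category_functor_comp:
  assumes "category_functor C D F" and "category_functor D E G"
  shows "category_functor C E (G \<odot> F)"
proof -
  interpret F: category_functor C D F by fact
  interpret G: category_functor D E G by fact
  show ?thesis
    by unfold_locales
      (auto simp: F.omap_closed G.omap_closed F.amap_idn G.amap_idn F.amap_cmp
        intro: F.amap_hom G.amap_hom G.amap_cmp)
qed

text \<open>The naturality square at \<open>f\<close> is pasted from two: the image under
  \<open>H\<close> of the square of \<open>\<alpha>\<close> at \<open>f\<close>, and the square of
  \<open>\<beta>\<close> at \<open>amap G f\<close>.\<close>

lemma natural_transformation_hcomp: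
  assumes "natural_transformation C D F G \<alpha>" and "natural_transformation D E H K \<beta>"
  shows "natural_transformation C E (H \<odot> F) (K \<odot> G) (hcomp E H G \<beta> \<alpha>)"
proof -
  interpret \<alpha>: natural_transformation C D F G \<alpha> by fact
  interpret \<beta>: natural_transformation D E H K \<beta> by fact
  interpret HF: category_functor C E "H \<odot> F"
    by (rule category_functor_comp) unfold_locales
  interpret KG: category_functor C E "K \<odot> G"
    by (rule category_functor_comp) unfold_locales
  have H\<alpha>: "amap H (\<alpha> x) \<in> hom E (omap H (omap F x)) (omap H (omap G x))" if "x \<in> Ob C" for x
    using that by (intro \<beta>.source.amap_hom \<alpha>.component_hom)
  have \<beta>G: "\<beta> (omap G x) \<in> hom E (omap H (omap G x)) (omap K (omap G x))" if "x \<in> Ob C" for x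
    using that by (intro \<beta>.component_hom \<alpha>.target.omap_closed)
  show ?thesis
  proof unfold_locales
    fix x assume "x \<in> Ob C"
    then show "hcomp E H G \<beta> \<alpha> x \<in> hom E (omap (H \<odot> F) x) (omap (K \<odot> G) x)"
      using H\<alpha> \<beta>G by (auto simp: nt_component_defs intro: \<beta>.source.target.cmp_hom)
  next
    fix f x y assume f: "f \<in> hom C x y"
    then have x: "x \<in> Ob C" and y: "y \<in> Ob C"
      using \<alpha>.source.source.dom_closed \<alpha>.source.source.cod_closed by (auto simp: hom_def)
    have Ff: "amap F f \<in> hom D (omap F x) (omap F y)" and Gf: "amap G f \<in> hom D (omap G x) (omap G y)"
      using f by (auto intro: \<alpha>.source.amap_hom \<alpha>.target.amap_hom)
    note assoc = \<beta>.source.target.cmp_assoc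
    have "(\<beta> (omap G y) \<cdot>\<^bsub>E\<^esub> amap H (\<alpha> y)) \<cdot>\<^bsub>E\<^esub> amap H (amap F f)
        = \<beta> (omap G y) \<cdot>\<^bsub>E\<^esub> amap H (\<alpha> y) \<cdot>\<^bsub>E\<^esub> amap H (amap F f)"
      by (rule assoc[OF \<beta>.source.amap_hom[OF Ff] H\<alpha>[OF y] \<beta>G[OF y]])
    also have "\<dots> = \<beta> (omap G y) \<cdot>\<^bsub>E\<^esub> amap H (amap G f) \<cdot>\<^bsub>E\<^esub> amap H (\<alpha> x)"
      using \<beta>.source.amap_cmp[OF Ff \<alpha>.component_hom[OF y]]
        \<beta>.source.amap_cmp[OF \<alpha>.component_hom[OF x] Gf] \<alpha>.natural[OF f] by simp
    also have "\<dots> = (\<beta> (omap G y) \<cdot>\<^bsub>E\<^esub> amap H (amap G f)) \<cdot>\<^bsub>E\<^esub> amap H (\<alpha> x)"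
      by (rule assoc[OF H\<alpha>[OF x] \<beta>.source.amap_hom[OF Gf] \<beta>G[OF y], symmetric])
    also have "\<dots> = (amap K (amap G f) \<cdot>\<^bsub>E\<^esub> \<beta> (omap G x)) \<cdot>\<^bsub>E\<^esub> amap H (\<alpha> x)"
      using \<beta>.natural[OF Gf] by simp
    also have "\<dots> = amap K (amap G f) \<cdot>\<^bsub>E\<^esub> \<beta> (omap G x) \<cdot>\<^bsub>E\<^esub> amap H (\<alpha> x)"
      by (rule assoc[OF H\<alpha>[OF x] \<beta>G[OF x] \<beta>.target.amap_hom[OF Gf]])
    finally show "hcomp E H G \<beta> \<alpha> y \<cdot>\<^bsub>E\<^esub> amap (H \<odot> F) f
        = amap (K \<odot> G) f \<cdot>\<^bsub>E\<^esub> hcomp E H G \<beta> \<alpha> x"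
      by (simp add: nt_component_defs)
  qed
qed

text \<open>Interchange law: at \<open>x\<close> this is naturality of \<open>\<beta>\<close> at the
  arrow \<open>\<alpha> x\<close>.\<close>

lemma hcomp_eq:
  assumes "natural_transformation C D F G \<alpha>" and "natural_transformation D E H K \<beta>"
  shows "hcomp E H G \<beta> \<alpha> \<doteq>\<^bsub>C\<^esub> (K \<triangleright> \<alpha>) \<bullet>\<^bsub>E\<^esub> (\<beta> \<triangleleft> F)"
proof -
  interpret \<alpha>: natural_transformation C D F G \<alpha> by fact
  interpret \<beta>: natural_transformation D E H K \<beta> by fact
  show ?thesis
    by (simp add: nt_component_defs \<beta>.natural[OF \<alpha>.component_hom])
qed

section \<open>Coalgebras and opcoalgebras over a distributive law\<close>

context comonad_distributive_law
begin

text \<open>Unfolding \<open>hcomp\<close> gives the form in which \<open>T\<close> acts on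
  \<open>nabla\<close>; interchange, with \<open>\<I>\<close> acting trivially, yields the form in
  which the counit comes first.\<close>

lemma hcomp_counit_coaction_eq:
  assumes "coalgebra B S \<Delta>S \<epsilon>S Y M nabla"
  shows "hcomp B T (S \<odot> M) \<epsilon>T nabla \<doteq>\<^bsub>Y\<^esub> nabla \<bullet>\<^bsub>B\<^esub> (\<epsilon>T \<triangleleft> M)"
proof -
  interpret M: coalgebra B S \<Delta>S \<epsilon>S Y M nabla by fact
  show ?thesis
    using hcomp_eq[OF M.coact.natural_transformation_axioms T.counit.natural_transformation_axioms]
    by (simp add: nt_component_defs)
qed

text \<open>The counit axiom is the counit law of \<open>nabla\<close> precomposed with
  \<open>\<epsilon>T\<close>. The work lies in the comultiplication axiom, whose right-hand side is
  simplified from the innermost factor outwards.\<close>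

lemma right_chi_coalgebra_of_coalgebra:
  assumes "coalgebra B S \<Delta>S \<epsilon>S Y M nabla"
  shows "right_chi_coalgebra B T \<Delta>T \<epsilon>T S \<Delta>S \<epsilon>S \<chi> Y M (hcomp B T (S \<odot> M) \<epsilon>T nabla)"
proof -
  interpret M: coalgebra B S \<Delta>S \<epsilon>S Y M nabla by fact
  let ?\<rho> = "hcomp B T (S \<odot> M) \<epsilon>T nabla"
  interpret \<rho>: natural_transformation Y B "T \<odot> M" "S \<odot> M" ?\<rho>
    using natural_transformation_hcomp[OF M.coact.natural_transformation_axioms
        T.counit.natural_transformation_axioms] by simp
  note assoc = T.source.cmp_assoc
  have \<rho>: "?\<rho> y = nabla y \<cdot>\<^bsub>B\<^esub> \<epsilon>T (omap M y)" if "y \<in> Ob Y" for y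
    using hcomp_counit_coaction_eq[OF assms] that by (simp add: nt_component_defs)
  \<comment> \<open>\<open>nt_eq\<close> compares components at objects only, so both axioms may be
    checked at a fixed \<open>y\<close>.\<close>
  have axioms_at:
    "\<epsilon>S (omap M y) \<cdot>\<^bsub>B\<^esub> ?\<rho> y = \<epsilon>T (omap M y) \<and>
     \<Delta>S (omap M y) \<cdot>\<^bsub>B\<^esub> ?\<rho> y =
       amap S (?\<rho> y) \<cdot>\<^bsub>B\<^esub> \<chi> (omap M y) \<cdot>\<^bsub>B\<^esub> amap T (?\<rho> y) \<cdot>\<^bsub>B\<^esub> \<Delta>T (omap M y)"
    if y: "y \<in> Ob Y" for y
  proof -
    define m where "m = omap M y"
    have m: "m \<in> Ob B"
      using M.coact_source.omap_closed y by (simp add: m_def)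
    have nabla: "nabla y \<in> hom B m (omap S m)"
      using M.coact.component_hom[OF y] by (simp add: m_def)
    have \<epsilon>T: "\<epsilon>T m \<in> hom B (omap T m) m" and \<epsilon>S: "\<epsilon>S m \<in> hom B (omap S m) m"
      using T.counit.component_hom[OF m] S.counit.component_hom[OF m] by simp_all
    have \<Delta>T: "\<Delta>T m \<in> hom B (omap T m) (omap T (omap T m))"
      and \<Delta>S: "\<Delta>S m \<in> hom B (omap S m) (omap S (omap S m))"
      using T.comult.component_hom[OF m] S.comult.component_hom[OF m] by simp_all
    have \<chi>: "\<chi> m \<in> hom B (omap T (omap S m)) (omap S (omap T m))"
      using law.component_hom[OF m] by simp
    note S\<epsilon>T = S.amap_hom[OF \<epsilon>T] and T\<epsilon>T = T.amap_hom[OF \<epsilon>T]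
    note S_nabla = S.amap_hom[OF nabla] and T_nabla = T.amap_hom[OF nabla]
    have counit: "\<epsilon>S m \<cdot>\<^bsub>B\<^esub> nabla y = Idn B m"
      and coassoc: "\<Delta>S m \<cdot>\<^bsub>B\<^esub> nabla y = amap S (nabla y) \<cdot>\<^bsub>B\<^esub> nabla y"
      using M.coact_counit M.coact_coassoc y by (simp_all add: nt_component_defs m_def)
    \<comment> \<open>Naturality of \<open>\<epsilon>T\<close> at the arrow \<open>nabla y\<close>;
      its target functor \<open>\<I>\<close> leaves that arrow unchanged.\<close>
    have nat: "nabla y \<cdot>\<^bsub>B\<^esub> \<epsilon>T m = \<epsilon>T (omap S m) \<cdot>\<^bsub>B\<^esub> amap T (nabla y)"
      using T.counit.natural[OF nabla] by simp
    have law: "amap S (\<epsilon>T m) \<cdot>\<^bsub>B\<^esub> \<chi> m = \<epsilon>T (omap S m)"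
      and T_counit: "amap T (\<epsilon>T m) \<cdot>\<^bsub>B\<^esub> \<Delta>T m = Idn B (omap T m)"
      using law_counit_T T.counit_right m by (simp_all add: nt_component_defs)
    have "\<epsilon>S m \<cdot>\<^bsub>B\<^esub> nabla y \<cdot>\<^bsub>B\<^esub> \<epsilon>T m = \<epsilon>T m"
      using assoc[OF \<epsilon>T nabla \<epsilon>S] counit T.source.cmp_idn_left[OF \<epsilon>T] by simp
    moreover have "amap S (nabla y \<cdot>\<^bsub>B\<^esub> \<epsilon>T m) \<cdot>\<^bsub>B\<^esub> \<chi> m \<cdot>\<^bsub>B\<^esub> amap T (nabla y \<cdot>\<^bsub>B\<^esub> \<epsilon>T m) \<cdot>\<^bsub>B\<^esub> \<Delta>T m
        = \<Delta>S m \<cdot>\<^bsub>B\<^esub> nabla y \<cdot>\<^bsub>B\<^esub> \<epsilon>T m"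
    proof -
      \<comment> \<open>The factor \<open>T\<close> applied to the counit meets
        \<open>\<Delta>T\<close>, so the right counit law of \<open>T\<close> cancels the
        pair.\<close>
      have "amap T (nabla y \<cdot>\<^bsub>B\<^esub> \<epsilon>T m) \<cdot>\<^bsub>B\<^esub> \<Delta>T m = amap T (nabla y)"
        using T.amap_cmp[OF \<epsilon>T nabla] assoc[OF \<Delta>T T\<epsilon>T T_nabla] T_counit
          T.source.cmp_idn_right[OF T_nabla] by simp
      then have "amap S (nabla y \<cdot>\<^bsub>B\<^esub> \<epsilon>T m) \<cdot>\<^bsub>B\<^esub> \<chi> m \<cdot>\<^bsub>B\<^esub> amap T (nabla y \<cdot>\<^bsub>B\<^esub> \<epsilon>T m) \<cdot>\<^bsub>B\<^esub> \<Delta>T m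
          = (amap S (nabla y) \<cdot>\<^bsub>B\<^esub> amap S (\<epsilon>T m)) \<cdot>\<^bsub>B\<^esub> \<chi> m \<cdot>\<^bsub>B\<^esub> amap T (nabla y)"
        using S.amap_cmp[OF \<epsilon>T nabla] by simp
      \<comment> \<open>Reassociation brings \<open>amap S (\<epsilon>T m)\<close> next to
        \<open>\<chi> m\<close>, where the counit law of \<open>\<chi>\<close> for \<open>T\<close>
        applies.\<close>
      also have "\<dots> = amap S (nabla y) \<cdot>\<^bsub>B\<^esub> (amap S (\<epsilon>T m) \<cdot>\<^bsub>B\<^esub> \<chi> m) \<cdot>\<^bsub>B\<^esub> amap T (nabla y)"
        using assoc[OF T.source.cmp_hom[OF T_nabla \<chi>] S\<epsilon>T S_nabla] assoc[OF T_nabla \<chi> S\<epsilon>T] by simp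
      also have "\<dots> = amap S (nabla y) \<cdot>\<^bsub>B\<^esub> nabla y \<cdot>\<^bsub>B\<^esub> \<epsilon>T m"
        using law nat by simp
      also have "\<dots> = \<Delta>S m \<cdot>\<^bsub>B\<^esub> nabla y \<cdot>\<^bsub>B\<^esub> \<epsilon>T m"
        using assoc[OF \<epsilon>T nabla S_nabla] assoc[OF \<epsilon>T nabla \<Delta>S] coassoc by simp
      finally show ?thesis .
    qed
    ultimately show ?thesis
      using \<rho>[OF y] by (simp add: m_def)
  qed
  show ?thesis
  proof unfold_locales
    show "(\<epsilon>S \<triangleleft> M) \<bullet>\<^bsub>B\<^esub> ?\<rho> \<doteq>\<^bsub>Y\<^esub> \<epsilon>T \<triangleleft> M"
      using axioms_at by (simp add: nt_eq_def vcomp_def whisker_left_def whisker_right_def)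
    show "(\<Delta>S \<triangleleft> M) \<bullet>\<^bsub>B\<^esub> ?\<rho> \<doteq>\<^bsub>Y\<^esub>
        (S \<triangleright> ?\<rho>) \<bullet>\<^bsub>B\<^esub> (\<chi> \<triangleleft> M) \<bullet>\<^bsub>B\<^esub> (T \<triangleright> ?\<rho>) \<bullet>\<^bsub>B\<^esub> (\<Delta>T \<triangleleft> M)"
      using axioms_at by (simp add: nt_eq_def vcomp_def whisker_left_def whisker_right_def)
  qed
qed

text \<open>Dual argument. Here \<open>\<epsilon>S\<close> has target functor \<open>\<I>\<close>,
  so \<open>hcomp\<close> unfolds directly to the form with \<open>amap N (\<epsilon>S x)\<close>
  applied first.\<close>

lemma left_chi_coalgebra_of_opcoalgebra:
  assumes "opcoalgebra B T \<Delta>T \<epsilon>T Z N nabla"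
  shows "left_chi_coalgebra B T \<Delta>T \<epsilon>T S \<Delta>S \<epsilon>S \<chi> Z N (hcomp Z N \<I> nabla \<epsilon>S)"
proof -
  interpret N: opcoalgebra B T \<Delta>T \<epsilon>T Z N nabla by fact
  let ?\<Lambda> = "hcomp Z N \<I> nabla \<epsilon>S"
  interpret \<Lambda>: natural_transformation B Z "N \<odot> S" "N \<odot> T" ?\<Lambda>
    using natural_transformation_hcomp[OF S.counit.natural_transformation_axioms
        N.coact.natural_transformation_axioms] by simp
  note assoc = N.coact_source.target.cmp_assoc
  have \<Lambda>: "?\<Lambda> x = nabla x \<cdot>\<^bsub>Z\<^esub> amap N (\<epsilon>S x)" for x
    by (simp add: nt_component_defs)
  have axioms_at:
    "amap N (\<epsilon>T b) \<cdot>\<^bsub>Z\<^esub> ?\<Lambda> b = amap N (\<epsilon>S b) \<and>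
     amap N (\<Delta>T b) \<cdot>\<^bsub>Z\<^esub> ?\<Lambda> b =
       ?\<Lambda> (omap T b) \<cdot>\<^bsub>Z\<^esub> amap N (\<chi> b) \<cdot>\<^bsub>Z\<^esub> ?\<Lambda> (omap S b) \<cdot>\<^bsub>Z\<^esub> amap N (\<Delta>S b)"
    if b: "b \<in> Ob B" for b
  proof -
    have Sb: "omap S b \<in> Ob B" and Tb: "omap T b \<in> Ob B"
      using b by (auto intro: S.omap_closed T.omap_closed)
    have \<epsilon>T: "\<epsilon>T b \<in> hom B (omap T b) b" and \<epsilon>S: "\<epsilon>S b \<in> hom B (omap S b) b"
      and \<epsilon>ST: "\<epsilon>S (omap T b) \<in> hom B (omap S (omap T b)) (omap T b)"
      and \<epsilon>SS: "\<epsilon>S (omap S b) \<in> hom B (omap S (omap S b)) (omap S b)"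
      using T.counit.component_hom[OF b] S.counit.component_hom[OF b]
        S.counit.component_hom[OF Tb] S.counit.component_hom[OF Sb] by simp_all
    have \<Delta>T: "\<Delta>T b \<in> hom B (omap T b) (omap T (omap T b))"
      and \<Delta>S: "\<Delta>S b \<in> hom B (omap S b) (omap S (omap S b))"
      using T.comult.component_hom[OF b] S.comult.component_hom[OF b] by simp_all
    have \<chi>: "\<chi> b \<in> hom B (omap T (omap S b)) (omap S (omap T b))"
      using law.component_hom[OF b] by simp
    have nabla: "nabla b \<in> hom Z (omap N b) (omap N (omap T b))"
      and nabla_S: "nabla (omap S b) \<in> hom Z (omap N (omap S b)) (omap N (omap T (omap S b)))"
      and nabla_T: "nabla (omap T b) \<in> hom Z (omap N (omap T b)) (omap N (omap T (omap T b)))"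
      using N.coact.component_hom[OF b] N.coact.component_hom[OF Sb]
        N.coact.component_hom[OF Tb] by simp_all
    note N_hom = N.coact_source.amap_hom and N_cmp = N.coact_source.amap_cmp
    have counit: "amap N (\<epsilon>T b) \<cdot>\<^bsub>Z\<^esub> nabla b = Idn Z (omap N b)"
      and coassoc: "amap N (\<Delta>T b) \<cdot>\<^bsub>Z\<^esub> nabla b = nabla (omap T b) \<cdot>\<^bsub>Z\<^esub> nabla b"
      using N.coact_counit N.coact_coassoc b by (simp_all add: nt_component_defs)
    \<comment> \<open>Naturality of the coaction at the arrow \<open>\<epsilon>S b\<close>.\<close>
    have nat: "nabla b \<cdot>\<^bsub>Z\<^esub> amap N (\<epsilon>S b) = amap N (amap T (\<epsilon>S b)) \<cdot>\<^bsub>Z\<^esub> nabla (omap S b)"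
      using N.coact.natural[OF \<epsilon>S] by simp
    \<comment> \<open>The left counit law of \<open>S\<close> is the relevant one: the component of
      \<open>?\<Lambda>\<close> at \<open>omap S b\<close> contributes the counit at
      \<open>omap S b\<close>, which meets \<open>\<Delta>S b\<close> under
      \<open>N\<close>.\<close>
    have law: "\<epsilon>S (omap T b) \<cdot>\<^bsub>B\<^esub> \<chi> b = amap T (\<epsilon>S b)"
      and S_counit: "\<epsilon>S (omap S b) \<cdot>\<^bsub>B\<^esub> \<Delta>S b = Idn B (omap S b)"
      using law_counit_S S.counit_left b by (simp_all add: nt_component_defs)
    have "amap N (\<epsilon>T b) \<cdot>\<^bsub>Z\<^esub> ?\<Lambda> b = amap N (\<epsilon>S b)"
      using assoc[OF N_hom[OF \<epsilon>S] nabla N_hom[OF \<epsilon>T]] counit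
        N.coact_source.target.cmp_idn_left[OF N_hom[OF \<epsilon>S]] by (simp add: \<Lambda>)
    moreover have "?\<Lambda> (omap T b) \<cdot>\<^bsub>Z\<^esub> amap N (\<chi> b) \<cdot>\<^bsub>Z\<^esub> ?\<Lambda> (omap S b) \<cdot>\<^bsub>Z\<^esub> amap N (\<Delta>S b)
        = amap N (\<Delta>T b) \<cdot>\<^bsub>Z\<^esub> ?\<Lambda> b"
    proof -
      have "?\<Lambda> (omap S b) \<cdot>\<^bsub>Z\<^esub> amap N (\<Delta>S b) = nabla (omap S b)"
        using assoc[OF N_hom[OF \<Delta>S] N_hom[OF \<epsilon>SS] nabla_S] N_cmp[OF \<Delta>S \<epsilon>SS] S_counit
          N.coact_source.amap_idn[OF Sb] N.coact_source.target.cmp_idn_right[OF nabla_S]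
        by (simp add: \<Lambda>)
      then have "?\<Lambda> (omap T b) \<cdot>\<^bsub>Z\<^esub> amap N (\<chi> b) \<cdot>\<^bsub>Z\<^esub> ?\<Lambda> (omap S b) \<cdot>\<^bsub>Z\<^esub> amap N (\<Delta>S b)
          = (nabla (omap T b) \<cdot>\<^bsub>Z\<^esub> amap N (\<epsilon>S (omap T b))) \<cdot>\<^bsub>Z\<^esub> amap N (\<chi> b) \<cdot>\<^bsub>Z\<^esub> nabla (omap S b)"
        by (simp add: \<Lambda>)
      \<comment> \<open>Reassociation puts the images under \<open>N\<close> of
        \<open>\<chi> b\<close> and of the counit at \<open>omap T b\<close> side by side;
        functoriality of \<open>N\<close> and the counit law of \<open>\<chi>\<close> for
        \<open>S\<close> then merge them into one arrow, to which \<open>nat\<close>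
        applies.\<close>
      also have "\<dots> = nabla (omap T b) \<cdot>\<^bsub>Z\<^esub>
          (amap N (\<epsilon>S (omap T b)) \<cdot>\<^bsub>Z\<^esub> amap N (\<chi> b)) \<cdot>\<^bsub>Z\<^esub> nabla (omap S b)"
        using assoc[OF N.coact_source.target.cmp_hom[OF nabla_S N_hom[OF \<chi>]] N_hom[OF \<epsilon>ST] nabla_T]
          assoc[OF nabla_S N_hom[OF \<chi>] N_hom[OF \<epsilon>ST]] by simp
      also have "\<dots> = nabla (omap T b) \<cdot>\<^bsub>Z\<^esub> nabla b \<cdot>\<^bsub>Z\<^esub> amap N (\<epsilon>S b)"
        using N_cmp[OF \<chi> \<epsilon>ST] law nat by simp
      also have "\<dots> = amap N (\<Delta>T b) \<cdot>\<^bsub>Z\<^esub> ?\<Lambda> b"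
        using assoc[OF N_hom[OF \<epsilon>S] nabla nabla_T] assoc[OF N_hom[OF \<epsilon>S] nabla N_hom[OF \<Delta>T]] coassoc
        by (simp add: \<Lambda>)
      finally show ?thesis .
    qed
    ultimately show ?thesis by simp
  qed
  show ?thesis
  proof unfold_locales
    show "(N \<triangleright> \<epsilon>T) \<bullet>\<^bsub>Z\<^esub> ?\<Lambda> \<doteq>\<^bsub>B\<^esub> N \<triangleright> \<epsilon>S"
      using axioms_at by (simp add: nt_eq_def vcomp_def whisker_left_def whisker_right_def)
    show "(N \<triangleright> \<Delta>T) \<bullet>\<^bsub>Z\<^esub> ?\<Lambda> \<doteq>\<^bsub>B\<^esub>
        (?\<Lambda> \<triangleleft> T) \<bullet>\<^bsub>Z\<^esub> (N \<triangleright> \<chi>) \<bullet>\<^bsub>Z\<^esub> (?\<Lambda> \<triangleleft> S) \<bullet>\<^bsub>Z\<^esub> (N \<triangleright> \<Delta>S)"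
      using axioms_at by (simp add: nt_eq_def vcomp_def whisker_left_def whisker_right_def)
  qed
qed

end

theorem proposition3p5:
  fixes B :: "('o, 'm) cat"
    and T S :: "('o, 'm, 'o, 'm) func"
    and \<Delta>T \<epsilon>T \<Delta>S \<epsilon>S \<chi> :: "'o \<Rightarrow> 'm"
  assumes "comonad_distributive_law B T \<Delta>T \<epsilon>T S \<Delta>S \<epsilon>S \<chi>"
  shows "(\<forall>(Y :: ('yo, 'ym) cat) (M :: ('yo, 'ym, 'o, 'm) func) nablaS.
            coalgebra B S \<Delta>S \<epsilon>S Y M nablaS \<longrightarrow>
              right_chi_coalgebra B T \<Delta>T \<epsilon>T S \<Delta>S \<epsilon>S \<chi> Y M (hcomp B T (S \<odot> M) \<epsilon>T nablaS) \<and>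
              hcomp B T (S \<odot> M) \<epsilon>T nablaS \<doteq>\<^bsub>Y\<^esub> nablaS \<bullet>\<^bsub>B\<^esub> (\<epsilon>T \<triangleleft> M)) \<and>
         (\<forall>(Z :: ('zo, 'zm) cat) (N :: ('o, 'm, 'zo, 'zm) func) nablaT.
            opcoalgebra B T \<Delta>T \<epsilon>T Z N nablaT \<longrightarrow>
              left_chi_coalgebra B T \<Delta>T \<epsilon>T S \<Delta>S \<epsilon>S \<chi> Z N (hcomp Z N \<I> nablaT \<epsilon>S) \<and>
              hcomp Z N \<I> nablaT \<epsilon>S \<doteq>\<^bsub>B\<^esub> nablaT \<bullet>\<^bsub>Z\<^esub> (N \<triangleright> \<epsilon>S))"
proof -
  interpret comonad_distributive_law B T \<Delta>T \<epsilon>T S \<Delta>S \<epsilon>S \<chi> by fact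
  \<comment> \<open>Whiskering \<open>nablaT\<close> with \<open>\<I>\<close> changes nothing, so
    both sides have the same components by definition.\<close>
  have "hcomp Z N \<I> nablaT \<epsilon>S \<doteq>\<^bsub>B\<^esub> nablaT \<bullet>\<^bsub>Z\<^esub> (N \<triangleright> \<epsilon>S)"
    for Z :: "('zo, 'zm) cat" and N :: "('o, 'm, 'zo, 'zm) func" and nablaT
    by (simp add: nt_component_defs)
  then show ?thesis
    using right_chi_coalgebra_of_coalgebra hcomp_counit_coaction_eq
      left_chi_coalgebra_of_opcoalgebra by blast
qed

end
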